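(* For every positive integer $n$, the determinant of the $n\times n$ matrix $\mathcal B=\left[\frac{1}{\beta(i,j)}\right]_{i,j=1}^{n}$ is equal to $n!$.
   Context: Here $\beta(x,y)=\frac{\Gamma(x)\Gamma(y)}{\Gamma(x+y)}$ is the beta function, so $\frac{1}{\beta(i,j)}=\frac{(i+j-1)!}{(i-1)!(j-1)!}$ for positive integers $i,j$. *)

theory Defs
  imports "HOL-Analysis.Gamma_Function" "Jordan_Normal_Form.Determinant"
begin

text \<open>Matrices are indexed from 0, hence the index shift: the entry at position \<open>(i, j)\<close>
  with \<open>i, j < n\<close> is the reciprocal of the beta function at \<open>(i + 1, j + 1)\<close>.\<close>

definition inverse_beta_matrix :: "nat \<Rightarrow> real mat" where
  "inverse_beta_matrix n = Matrix.mat n n (\<lambda>(i, j). 1 / Beta (real (i + 1)) (real (j + 1)))"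

end

theory Submission
  imports Defs
begin

text \<open>Since \<open>1 / Beta (i + 1) (j + 1) = (i + j + 1)! / (i! j!) = (i + 1) (i + j + 1 choose j)\<close>, the
  matrix is a Pascal matrix shifted by one, with row \<open>i\<close> multiplied by \<open>i + 1\<close>. Vandermonde's
  convolution, splitting \<open>i + j + 1\<close> as \<open>i + (j + 1)\<close>, is exactly an LU factorisation of the
  Pascal part: both factors consist of binomial coefficients and are unitriangular (the other
  split, \<open>(i + 1) + j\<close>, would give entries \<open>i + 1 choose k\<close>, which are not triangular). When the row
  multipliers are absorbed into the lower factor, its diagonal becomes \<open>1, 2, \<dots>, n\<close>, and the
  determinant is the product \<open>n!\<close> of these entries.\<close>

text \<open>The symmetry \<open>(j + 1 choose j - k) = (j + 1 choose k + 1)\<close> turns each Vandermonde term into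
  an entry depending on \<open>i, k\<close> times one depending on \<open>k, j\<close>. The terms with \<open>k > j\<close> vanish, so
  the summation range can be the same for all \<open>j < n\<close>, as a matrix product requires.\<close>
lemma shifted_Pascal_LU:
  assumes "j < n"
  shows "(i + j + 1) choose j = (\<Sum>k<n. (i choose k) * ((j + 1) choose (k + 1)))"
proof -
  have "(i + (j + 1)) choose j = (\<Sum>k\<le>j. (i choose k) * ((j + 1) choose (j - k)))"
    by (simp add: vandermonde)
  also have "\<dots> = (\<Sum>k\<le>j. (i choose k) * ((j + 1) choose (k + 1)))"
    by (intro sum.cong refl) (subst binomial_symmetric, auto simp: Suc_diff_le)
  also have "\<dots> = (\<Sum>k<n. (i choose k) * ((j + 1) choose (k + 1)))"
    using assms by (intro sum.mono_neutral_left) auto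
  finally show ?thesis by (simp add: add.assoc)
qed

lemma inverse_Beta_eq_binomial:
  "1 / Beta (real (i + 1)) (real (j + 1)) = real (i + 1) * real ((i + j + 1) choose j)"
proof -
  have "Gamma (real (i + 1)) = fact i" "Gamma (real (j + 1)) = fact j"
    using Gamma_fact[of i, where 'a = real] Gamma_fact[of j, where 'a = real]
    by (simp_all add: add.commute)
  moreover have "Gamma (real (i + 1) + real (j + 1)) = fact (i + j + 1)"
    using Gamma_fact[of "i + j + 1", where 'a = real] by (simp add: algebra_simps)
  moreover have "real ((i + j + 1) choose j) = fact (i + j + 1) / (fact j * fact (i + 1))"
    by (subst binomial_fact) auto
  ultimately show ?thesis
    by (simp add: Beta_def field_simps del: of_nat_Suc of_nat_add)
qed

definition scaled_Pascal_lower :: "nat \<Rightarrow> real mat" where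
  "scaled_Pascal_lower n = Matrix.mat n n (\<lambda>(i, k). real (i + 1) * real (i choose k))"

definition Pascal_upper :: "nat \<Rightarrow> real mat" where
  "Pascal_upper n = Matrix.mat n n (\<lambda>(k, j). real ((j + 1) choose (k + 1)))"

lemma inverse_beta_matrix_LU:
  "inverse_beta_matrix n = scaled_Pascal_lower n * Pascal_upper n"
proof (rule eq_matI)
  fix i j
  assume "i < dim_row (scaled_Pascal_lower n * Pascal_upper n)"
    and "j < dim_col (scaled_Pascal_lower n * Pascal_upper n)"
  then have ij: "i < n" "j < n"
    by (simp_all add: scaled_Pascal_lower_def Pascal_upper_def)
  have "inverse_beta_matrix n $$ (i, j) = real (i + 1) * real ((i + j + 1) choose j)"
    using ij inverse_Beta_eq_binomial[of i j] by (simp add: inverse_beta_matrix_def)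
  also have "\<dots> = (\<Sum>k<n. (real (i + 1) * real (i choose k)) * real ((j + 1) choose (k + 1)))"
    by (simp only: shifted_Pascal_LU[OF ij(2)] of_nat_sum of_nat_mult sum_distrib_left mult.assoc)
  also have "\<dots> = (scaled_Pascal_lower n * Pascal_upper n) $$ (i, j)"
    using ij by (simp add: scaled_Pascal_lower_def Pascal_upper_def scalar_prod_def
        lessThan_atLeast0 del: binomial_Suc_Suc)
  finally show "inverse_beta_matrix n $$ (i, j)
      = (scaled_Pascal_lower n * Pascal_upper n) $$ (i, j)" .
qed (simp_all add: inverse_beta_matrix_def scaled_Pascal_lower_def Pascal_upper_def)

lemma det_scaled_Pascal_lower: "Determinant.det (scaled_Pascal_lower n) = fact n"
proof -
  have "Determinant.det (scaled_Pascal_lower n) = prod_list (diag_mat (scaled_Pascal_lower n))"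
    by (rule det_lower_triangular[of n]) (auto simp: scaled_Pascal_lower_def)
  also have "\<dots> = (\<Prod>i = 0..<n. real (i + 1))"
    by (simp add: prod_list_diag_prod scaled_Pascal_lower_def)
  also have "\<dots> = fact n"
    by (simp add: fact_prod_Suc)
  finally show ?thesis .
qed

lemma det_Pascal_upper: "Determinant.det (Pascal_upper n) = 1"
proof -
  have "Determinant.det (Pascal_upper n) = prod_list (diag_mat (Pascal_upper n))"
    by (rule det_upper_triangular[of _ n]) (auto simp: Pascal_upper_def upper_triangular_def binomial_eq_0)
  then show ?thesis
    by (simp add: prod_list_diag_prod Pascal_upper_def binomial_eq_0)
qed

theorem corollary2p5:
  fixes n :: nat
  assumes "n \<ge> 1"
  shows "Determinant.det (inverse_beta_matrix n) = fact n"
proof -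
  have "scaled_Pascal_lower n \<in> carrier_mat n n" "Pascal_upper n \<in> carrier_mat n n"
    by (simp_all add: scaled_Pascal_lower_def Pascal_upper_def)
  then show ?thesis
    by (simp add: inverse_beta_matrix_LU det_mult det_scaled_Pascal_lower det_Pascal_upper)
qed

end
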